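(* Let $q,m\in\mathbb N$, $A=(a_{ij})\in\mathbb R^{q\times q}$, $b=(b_1,\dots,b_q)^\top\in\mathbb R^q$ and $c_i:=\sum_{j=1}^qa_{ij}$. The simplified controlled Runge-Kutta method with tableau $(A,b)$ has tree order $3$, i.e. $\widehat a(\tau)=1/\gamma(\tau)$ for all $\tau\in\mathcal T_{\le3}$, if and only if $$\sum_{i=1}^qb_i=1,\qquad\sum_{i=1}^qb_ic_i=\frac12,\qquad\sum_{i=1}^qb_ic_i^2=\frac13,\qquad\sum_{i,j=1}^qb_ia_{ij}c_j=\frac16.$$
   Context: $\mathcal T$ is the set of (nonplanar) rooted trees with vertices decorated by $\mathcal A=\{1,\dots,m\}$, $\mathbf 1$ the empty tree, $[\tau_1\cdots\tau_n]_a$ the tree obtained by joining the roots of $\tau_1,\dots,\tau_n$ to a new root decorated by $a$, $\bullet_a=[\mathbf 1]_a$, $|\tau|$ the number of vertices, $\mathcal T_{\le3}=\{\tau\in\mathcal T:|\tau|\le3\}$. Tree factorial: $\gamma(\mathbf 1)=\gamma(\bullet_a)=1$, $\gamma(\tau)=|\tau|\prod_{i=1}^k\gamma(\tau_i)$ for $\tau=[\tau_1\cdots\tau_k]_a$. With $\odot$ the componentwise product on $\mathbb R^q$ and $\mathbf 1_q=(1,\dots,1)^\top$ (the empty product): $\widehat\Phi(\mathbf 1)=\mathbf 1_q$, $\widehat\Phi([\tau_1\cdots\tau_n]_a)=A(\widehat\Phi(\tau_1)\odot\cdots\odot\widehat\Phi(\tau_n))$, $\widehat a(\mathbf 1)=1$,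 $\widehat a([\tau_1\cdots\tau_n]_a)=\langle b,\widehat\Phi(\tau_1)\odot\cdots\odot\widehat\Phi(\tau_n)\rangle_{\mathbb R^q}$. (The simplified method with tableau $(A,b)$, vector fields $F_a$ and driver increments $\Delta Z^a_{u,v}=Z^a_v-Z^a_u$ has stages $Y_i=y+\sum_{a,j}a_{ij}\Delta Z^a_{u,v}F_a(Y_j)$ and output $y+\sum_{a,i}b_i\Delta Z^a_{u,v}F_a(Y_i)$.) *)

theory Defs
  imports "HOL-Analysis.Analysis" "HOL-Library.Multiset"
begin

text \<open>
  Nonplanar rooted trees: the subtrees at a vertex form a multiset, so their order is
  irrelevant.  The empty tree is added on top, and the alphabet enters as a set of decorations.
\<close>

datatype (decorations: 'a) ntree = Node 'a "'a ntree multiset"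

datatype 'a tree = Empty | NonEmpty "'a ntree"

primrec tree_decorations :: "'a tree \<Rightarrow> 'a set" where
  "tree_decorations Empty = {}"
| "tree_decorations (NonEmpty t) = decorations t"

definition trees :: "'a set \<Rightarrow> 'a tree set" where
  "trees \<A> = {\<tau>. tree_decorations \<tau> \<subseteq> \<A>}"

primrec ntree_order :: "'a ntree \<Rightarrow> nat" where
  "ntree_order (Node a ts) = 1 + sum_mset (image_mset ntree_order ts)"

primrec tree_order :: "'a tree \<Rightarrow> nat" where
  "tree_order Empty = 0"
| "tree_order (NonEmpty t) = ntree_order t"

definition trees_upto :: "'a set \<Rightarrow> nat \<Rightarrow> 'a tree set" where
  "trees_upto \<A> n = {\<tau> \<in> trees \<A>. tree_order \<tau> \<le> n}"

primrec ntree_factorial :: "'a ntree \<Rightarrow> nat" where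
  "ntree_factorial (Node a ts) =
     ntree_order (Node a ts) * prod_mset (image_mset ntree_factorial ts)"

primrec tree_factorial :: "'a tree \<Rightarrow> nat" where
  "tree_factorial Empty = 1"
| "tree_factorial (NonEmpty t) = ntree_factorial t"

text \<open>
  On \<^typ>\<open>real ^ 'q\<close> the library's \<open>*\<close> and \<open>1\<close> are the componentwise product and the all-ones
  vector, so \<^const>\<open>prod_mset\<close> is the iterated componentwise product, with empty product \<open>1\<close>.
  Below, \<open>tree_stage A\<close> and \<open>tree_weight A b\<close> are the elementary stage vectors and weights usually
  written with a hat as \<open>\<Phi>\<close> and \<open>a\<close>.
\<close>

primrec ntree_stage :: "real ^ 'q ^ 'q \<Rightarrow> 'a ntree \<Rightarrow> real ^ 'q" where
  "ntree_stage A (Node a ts) = A *v prod_mset (image_mset (ntree_stage A) ts)"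

primrec tree_stage :: "real ^ 'q ^ 'q \<Rightarrow> 'a tree \<Rightarrow> real ^ 'q" where
  "tree_stage A Empty = 1"
| "tree_stage A (NonEmpty t) = ntree_stage A t"

primrec ntree_weight :: "real ^ 'q ^ 'q \<Rightarrow> real ^ 'q \<Rightarrow> 'a ntree \<Rightarrow> real" where
  "ntree_weight A b (Node a ts) = b \<bullet> prod_mset (image_mset (ntree_stage A) ts)"

primrec tree_weight :: "real ^ 'q ^ 'q \<Rightarrow> real ^ 'q \<Rightarrow> 'a tree \<Rightarrow> real" where
  "tree_weight A b Empty = 1"
| "tree_weight A b (NonEmpty t) = ntree_weight A b t"

definition has_tree_order :: "'a set \<Rightarrow> real ^ 'q ^ 'q \<Rightarrow> real ^ 'q \<Rightarrow> nat \<Rightarrow> bool" where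
  "has_tree_order \<A> A b p \<longleftrightarrow>
     (\<forall>\<tau> \<in> trees_upto \<A> p. tree_weight A b \<tau> = 1 / real (tree_factorial \<tau>))"

text \<open>
  Grafting \<open>[\<tau>\<^sub>1 \<cdots> \<tau>\<^sub>n]\<^sub>a\<close>.  Empty trees among the \<open>\<tau>\<^sub>i\<close> contribute no subtree, which gives
  \<open>[\<one>]\<^sub>a = \<bullet>\<^sub>a\<close>; the recursions above then hold for all arguments, empty or not.
\<close>

primrec forest_of :: "'a tree \<Rightarrow> 'a ntree multiset" where
  "forest_of Empty = {#}"
| "forest_of (NonEmpty t) = {#t#}"

definition graft :: "'a \<Rightarrow> 'a tree multiset \<Rightarrow> 'a tree" where
  "graft a \<tau>s = NonEmpty (Node a (sum_mset (image_mset forest_of \<tau>s)))"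

lemma graft_Empty: "graft a {#Empty#} = NonEmpty (Node a {#})"
  by (simp add: graft_def)

lemma graft_cases:
  obtains "\<tau> = Empty" | a \<tau>s where "\<tau> = graft a \<tau>s"
proof (cases \<tau>)
  case (NonEmpty t)
  obtain a ts where t: "t = Node a ts" by (cases t)
  have "sum_mset (image_mset forest_of (image_mset NonEmpty ts)) = ts"
    by (induction ts) auto
  then have "\<tau> = graft a (image_mset NonEmpty ts)"
    by (simp add: graft_def NonEmpty t)
  then show ?thesis using that by blast
qed (use that in blast)

lemma tree_decorations_graft:
  "tree_decorations (graft a \<tau>s) = insert a (\<Union>\<tau> \<in> set_mset \<tau>s. tree_decorations \<tau>)"
proof -
  have "(\<Union>t \<in> set_mset (sum_mset (image_mset forest_of \<tau>s)). decorations t) =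
      (\<Union>\<tau> \<in> set_mset \<tau>s. tree_decorations \<tau>)"
  proof (induction \<tau>s)
    case (add \<tau> \<tau>s)
    then show ?case by (cases \<tau>) auto
  qed simp
  then show ?thesis by (simp add: graft_def)
qed

lemma tree_order_graft:
  "tree_order (graft a \<tau>s) = 1 + sum_mset (image_mset tree_order \<tau>s)"
proof -
  have "sum_mset (image_mset ntree_order (sum_mset (image_mset forest_of \<tau>s))) =
      sum_mset (image_mset tree_order \<tau>s)"
  proof (induction \<tau>s)
    case (add \<tau> \<tau>s)
    then show ?case by (cases \<tau>) auto
  qed simp
  then show ?thesis by (simp add: graft_def)
qed

lemma tree_factorial_graft:
  "tree_factorial (graft a \<tau>s) =
     tree_order (graft a \<tau>s) * prod_mset (image_mset tree_factorial \<tau>s)"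
proof -
  have "prod_mset (image_mset ntree_factorial (sum_mset (image_mset forest_of \<tau>s))) =
      prod_mset (image_mset tree_factorial \<tau>s)"
  proof (induction \<tau>s)
    case (add \<tau> \<tau>s)
    then show ?case by (cases \<tau>) auto
  qed simp
  then show ?thesis by (simp add: graft_def)
qed

lemma prod_mset_stage_forest:
  "prod_mset (image_mset (ntree_stage A) (sum_mset (image_mset forest_of \<tau>s))) =
     prod_mset (image_mset (tree_stage A) \<tau>s)"
proof (induction \<tau>s)
  case (add \<tau> \<tau>s)
  then show ?case by (cases \<tau>) auto
qed simp

lemma tree_stage_graft:
  "tree_stage A (graft a \<tau>s) = A *v prod_mset (image_mset (tree_stage A) \<tau>s)"
  by (simp add: graft_def prod_mset_stage_forest)

lemma tree_weight_graft:
  "tree_weight A b (graft a \<tau>s) = b \<bullet> prod_mset (image_mset (tree_stage A) \<tau>s)"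
  by (simp add: graft_def prod_mset_stage_forest)

end

theory Submission
  imports Defs
begin

text \<open>
  Neither the weight nor the factorial of a tree sees its decorations, so tree order 3 is one
  scalar equation per undecorated shape with at most three vertices: the single vertex, the
  chain with two vertices, the chain with three vertices and the root carrying two leaves (on the
  empty tree both sides equal 1). The stage vector of a leaf is \<open>A *v 1 = c\<close>, hence the
  four weights are the inner products of \<open>b\<close> with \<open>1\<close>, \<open>c\<close>, \<open>A *v c\<close> and
  \<open>c * c\<close>, and the four factorials are 1, 2, 6 and 3. These are the four order conditions.

  That these conditions suffice rests on the completeness of the list of shapes,
  \<open>ntree_order_le_3_cases\<close>; that they are necessary, on every shape being realised, for which
  one decoration is enough.
\<close>

abbreviation forest_order :: "'a ntree multiset \<Rightarrow> nat" where
  "forest_order ts \<equiv> sum_mset (image_mset ntree_order ts)"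

abbreviation leaf :: "'a \<Rightarrow> 'a ntree" where
  "leaf a \<equiv> Node a {#}"

text \<open>
  Removing the root of one tree from a forest leaves two smaller forests; the small forests
  below are enumerated by iterating this step.
\<close>

lemma forest_order_Suc_cases:
  assumes "forest_order ts = Suc n"
  obtains a us vs where "ts = add_mset (Node a us) vs" "forest_order us + forest_order vs = n"
proof (cases ts)
  case empty
  then show ?thesis using assms by simp
next
  case (add t vs)
  then show ?thesis using assms that by (cases t) auto
qed

lemma forest_order_eq_0_iff: "forest_order ts = 0 \<longleftrightarrow> ts = {#}"
proof (cases ts)
  case (add t us)
  then show ?thesis by (cases t) simp
qed simp

lemma forest_order_eq_1_cases:
  assumes "forest_order ts = 1"
  obtains a where "ts = {#leaf a#}"
proof -
  have "forest_order ts = Suc 0" using assms by simp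
  then obtain a us vs where ts: "ts = add_mset (Node a us) vs"
    and 0: "forest_order us + forest_order vs = 0"
    by (rule forest_order_Suc_cases)
  have "us = {#}" "vs = {#}"
    using 0 by (simp_all only: add_is_0 forest_order_eq_0_iff)
  then show ?thesis using ts that by simp
qed

lemma forest_order_eq_2_cases:
  assumes "forest_order ts = 2"
  obtains (chain) a b where "ts = {#Node a {#leaf b#}#}"
    | (leaves) a b where "ts = {#leaf a, leaf b#}"
proof -
  have "forest_order ts = Suc 1" using assms by simp
  then obtain a us vs where ts: "ts = add_mset (Node a us) vs"
    and "forest_order us + forest_order vs = 1"
    by (rule forest_order_Suc_cases)
  then consider "forest_order us = 1" "forest_order vs = 0"
    | "forest_order us = 0" "forest_order vs = 1"
    by linarith
  then show ?thesis
  proof cases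
    case 1
    obtain b where "us = {#leaf b#}" using 1(1) by (rule forest_order_eq_1_cases)
    moreover have "vs = {#}" using 1(2) by (simp only: forest_order_eq_0_iff)
    ultimately show ?thesis using ts by (intro chain) simp
  next
    case 2
    obtain b where "vs = {#leaf b#}" using 2(2) by (rule forest_order_eq_1_cases)
    moreover have "us = {#}" using 2(1) by (simp only: forest_order_eq_0_iff)
    ultimately show ?thesis using ts by (intro leaves) simp
  qed
qed

lemma ntree_order_le_3_cases:
  assumes "ntree_order t \<le> 3"
  obtains (point) a where "t = leaf a"
    | (chain2) a b where "t = Node a {#leaf b#}"
    | (chain3) a b c where "t = Node a {#Node b {#leaf c#}#}"
    | (cherry) a b c where "t = Node a {#leaf b, leaf c#}"
proof -
  obtain a ts where t: "t = Node a ts" by (cases t)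
  have "forest_order ts \<le> 2" using assms by (simp add: t)
  then consider "forest_order ts = 0" | "forest_order ts = 1" | "forest_order ts = 2"
    by linarith
  then show ?thesis
  proof cases
    case 1
    then have "ts = {#}" by (simp only: forest_order_eq_0_iff)
    then show ?thesis using t point by blast
  next
    case 2
    then show ?thesis using t chain2 by (elim forest_order_eq_1_cases) simp
  next
    case 3
    then show ?thesis using t chain3 cherry by (elim forest_order_eq_2_cases) simp_all
  qed
qed

text \<open>
  A nonempty alphabet is needed: over the empty alphabet the only tree is the empty one, and
  every tableau has tree order 3.
\<close>

lemma has_tree_order_3_iff:
  fixes A :: "real ^ 'q ^ 'q" and b :: "real ^ 'q" and \<A> :: "'a set"
  assumes "\<A> \<noteq> {}"
  shows "has_tree_order \<A> A b 3 \<longleftrightarrow>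
    b \<bullet> 1 = 1 \<and> b \<bullet> (A *v 1) = 1 / 2 \<and>
    b \<bullet> (A *v 1 * (A *v 1)) = 1 / 3 \<and> b \<bullet> (A *v (A *v 1)) = 1 / 6"
    (is "_ \<longleftrightarrow> ?conds")
proof
  assume order: "has_tree_order \<A> A b 3"
  obtain a where a: "a \<in> \<A>" using assms by blast
  have weight: "ntree_weight A b t = 1 / real (ntree_factorial t)"
    if "decorations t \<subseteq> \<A>" "ntree_order t \<le> 3" for t
  proof -
    have "NonEmpty t \<in> trees_upto \<A> 3"
      using that by (simp add: trees_upto_def trees_def)
    then have "tree_weight A b (NonEmpty t) = 1 / real (tree_factorial (NonEmpty t))"
      using order unfolding has_tree_order_def by blast
    then show ?thesis by simp
  qed
  show ?conds
    using weight[of "leaf a"] weight[of "Node a {#leaf a#}"]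
      weight[of "Node a {#leaf a, leaf a#}"] weight[of "Node a {#Node a {#leaf a#}#}"] a
    by simp
next
  assume conds: ?conds
  have "ntree_weight A b t = 1 / real (ntree_factorial t)" if "ntree_order t \<le> 3" for t :: "'a ntree"
    using that conds by (cases t rule: ntree_order_le_3_cases) simp_all
  then have "tree_weight A b \<tau> = 1 / real (tree_factorial \<tau>)" if "tree_order \<tau> \<le> 3" for \<tau> :: "'a tree"
    using that by (cases \<tau>) simp_all
  then show "has_tree_order \<A> A b 3"
    by (simp add: has_tree_order_def trees_upto_def)
qed

theorem proposition5p9:
  fixes A :: "real ^ 'q ^ 'q" and b c :: "real ^ 'q" and m :: nat
  assumes "m \<ge> 1"
    and "\<And>i. c $ i = (\<Sum>j\<in>UNIV. A $ i $ j)"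
  shows "has_tree_order {1..m} A b 3 \<longleftrightarrow>
    (\<Sum>i\<in>UNIV. b $ i) = 1 \<and>
    (\<Sum>i\<in>UNIV. b $ i * c $ i) = 1 / 2 \<and>
    (\<Sum>i\<in>UNIV. b $ i * (c $ i)\<^sup>2) = 1 / 3 \<and>
    (\<Sum>i\<in>UNIV. \<Sum>j\<in>UNIV. b $ i * A $ i $ j * c $ j) = 1 / 6"
proof -
  have c: "A *v 1 = c"
    using assms(2) by (simp add: vec_eq_iff matrix_vector_mult_def)
  have "b \<bullet> 1 = (\<Sum>i\<in>UNIV. b $ i)"
    and "b \<bullet> c = (\<Sum>i\<in>UNIV. b $ i * c $ i)"
    and "b \<bullet> (c * c) = (\<Sum>i\<in>UNIV. b $ i * (c $ i)\<^sup>2)"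
    and "b \<bullet> (A *v c) = (\<Sum>i\<in>UNIV. \<Sum>j\<in>UNIV. b $ i * A $ i $ j * c $ j)"
    by (simp_all add: inner_vec_def power2_eq_square matrix_vector_mult_def
        sum_distrib_left mult.assoc)
  moreover have "{1..m} \<noteq> {}" using assms(1) by simp
  ultimately show ?thesis
    using has_tree_order_3_iff[of "{1..m}" A b] by (simp add: c)
qed

end
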